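(* Let $X$ be a Banach space and let $F:X\to X$ be a completely continuous, point dissipative map of class $C^1$, with connected global attractor $K$; assume that $F$ restricts to a homeomorphism of $K$ and that, with $\mathcal T(x)=D_xF$, the linear cocycle $(F,\mathcal T)$ on $K\times X$ admits a $k$-exponential separation. For $c\ge0$ let $B_c(K)=\{x\in X:\inf_{y\in K}\|x-y\|\le c\}$. Then for any sufficiently small $\delta\in(0,1)$ there is $\hat\delta_0>0$ such that for every $\hat\delta\in[0,\hat\delta_0]$ and every map $\tilde F_{nnh}:X\to X$ of class $C^1$ with $$\sup_{x\in X}\{\|\tilde F_{nnh}(x)-F(x)\|+\|D_x\tilde F_{nnh}-D_xF\|_{L(X)}\}\le\hat\delta,$$ there is a local attractor $\tilde K\subset B_\delta(K)$ under $\tilde F_{nnh}$ which attracts all bounded sets in $B_1(K)$ under $\tilde F_{nnh}$.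
   Context: A completely continuous map is a continuous map sending bounded sets to relatively compact sets. A set $A$ attracts a set $B$ under a map $f$ if $\sup_{b\in B}\mathrm{dist}(f^n(b),A)\to0$ as $n\to\infty$. $F$ is point dissipative if there is a bounded set attracting each point of $X$ under $F$. The global attractor $K$ is the maximal compact invariant set ($FK=K$) that attracts each bounded set of $X$ under $F$ (it exists and is connected for point dissipative completely continuous $F$). A local attractor under $f$ is a nonempty compact set $A$ with $f(A)=A$ that attracts some neighbourhood of itself under $f$. $L(X)$ is the space of bounded linear operators on $X$ with the operator norm; $S$ is the unit sphere of $X$. $k$ is a positive integer. $(F,\mathcal T)$ on $K\times X$, with $T_x=\mathcal T(x)$, $T^0_x=\mathrm{Id}$, $T^n_x=T_{F^{n-1}(x)}\circ T_x^{n-1}$, admits a $k$-exponential separation if there are families $\{P_x\}_{x\in K}$ of $k$-dimensional subspaces and $\{Q_x\}_{x\in K}$ of closed $k$-codimensional subspaces of $X$, with $x\mapsto P_x$ continuous in the gap metric on the set of $k$-dimensional subspaces of $X$ and $Q_x=\mathrm{Ker}(L_x)=\{v: l(v)=0\ \forall\, l\in L_x\}$ for a family of $k$-dimensional subspaces $L_x\subset X^*$ depending continuously on $x$ in the gap metric, such that $X=P_x\oplus Q_x$, $T_xP_x=P_{F(x)}$, $T_xQ_x\subset Q_{F(x)}$ for all $x\in K$, and there are $M>0$, $\gamma_0\in(0,1)$ with $\|T^n_xw\|\le M\gamma_0^n\|T^n_xv\|$ for all $x\in K$, $v\in P_x\cap S$, $w\in Q_x\cap S$, $n\in\mathbb N$.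 The gap metric is $d(H_1,H_2)=\max\{\sup_{v\in H_1\cap S}\inf_{u\in H_2\cap S}\|v-u\|,\ \sup_{v\in H_2\cap S}\inf_{u\in H_1\cap S}\|v-u\|\}$ (with $S$ the unit sphere of the relevant space). *)

theory Defs
  imports "HOL-Analysis.Analysis"
begin

definition completely_continuous :: "('a::metric_space \<Rightarrow> 'b::metric_space) \<Rightarrow> bool" where
  "completely_continuous f \<longleftrightarrow>
     continuous_on UNIV f \<and> (\<forall>B. bounded B \<longrightarrow> compact (closure (f ` B)))"

(* Supremum and infimum are taken in [0,\<infinity>], so that nothing but the empty set is
   attracted by the empty set and unbounded suprema do not collapse. *)
definition attracts :: "('a::metric_space \<Rightarrow> 'a) \<Rightarrow> 'a set \<Rightarrow> 'a set \<Rightarrow> bool" where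
  "attracts f A B \<longleftrightarrow>
     (\<lambda>n. SUP b\<in>B. INF a\<in>A. ennreal (dist ((f ^^ n) b) a)) \<longlonglongrightarrow> 0"

definition point_dissipative :: "('a::metric_space \<Rightarrow> 'a) \<Rightarrow> bool" where
  "point_dissipative f \<longleftrightarrow> (\<exists>B. bounded B \<and> (\<forall>x. attracts f B {x}))"

definition global_attractor :: "('a::metric_space \<Rightarrow> 'a) \<Rightarrow> 'a set \<Rightarrow> bool" where
  "global_attractor f K \<longleftrightarrow>
     compact K \<and> f ` K = K \<and> (\<forall>C. compact C \<and> f ` C = C \<longrightarrow> C \<subseteq> K) \<and>
     (\<forall>B. bounded B \<longrightarrow> attracts f K B)"

definition local_attractor :: "('a::metric_space \<Rightarrow> 'a) \<Rightarrow> 'a set \<Rightarrow> bool" where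
  "local_attractor f A \<longleftrightarrow>
     A \<noteq> {} \<and> compact A \<and> f ` A = A \<and> (\<exists>U. open U \<and> A \<subseteq> U \<and> attracts f A U)"

definition closed_nbhd :: "real \<Rightarrow> 'a::metric_space set \<Rightarrow> 'a set" where
  "closed_nbhd c K = {x. infdist x K \<le> c}"

definition fderiv :: "('a::real_normed_vector \<Rightarrow> 'b::real_normed_vector) \<Rightarrow> 'a \<Rightarrow> 'a \<Rightarrow>\<^sub>L 'b" where
  "fderiv f x = Blinfun (frechet_derivative f (at x))"

definition C1_map :: "('a::real_normed_vector \<Rightarrow> 'b::real_normed_vector) \<Rightarrow> bool" where
  "C1_map f \<longleftrightarrow> (\<forall>x. f differentiable (at x)) \<and> continuous_on UNIV (fderiv f)"

primrec cocycle_iter ::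
  "('a \<Rightarrow> 'a) \<Rightarrow> ('a \<Rightarrow> 'a \<Rightarrow>\<^sub>L 'a) \<Rightarrow> nat \<Rightarrow> 'a \<Rightarrow> 'a::real_normed_vector \<Rightarrow>\<^sub>L 'a" where
  "cocycle_iter F T 0 x = id_blinfun"
| "cocycle_iter F T (Suc n) x = T ((F ^^ n) x) o\<^sub>L cocycle_iter F T n x"

(* Meaningful for nonzero subspaces only: the unit spheres have to be nonempty. *)
definition gap :: "'a::real_normed_vector set \<Rightarrow> 'a set \<Rightarrow> real" where
  "gap H1 H2 =
     max (SUP v\<in>H1 \<inter> sphere 0 1. INF u\<in>H2 \<inter> sphere 0 1. norm (v - u))
         (SUP v\<in>H2 \<inter> sphere 0 1. INF u\<in>H1 \<inter> sphere 0 1. norm (v - u))"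

definition gap_continuous_on ::
  "'a::metric_space set \<Rightarrow> ('a \<Rightarrow> 'b::real_normed_vector set) \<Rightarrow> bool" where
  "gap_continuous_on K H \<longleftrightarrow> (\<forall>x\<in>K. ((\<lambda>y. gap (H y) (H x)) \<longlongrightarrow> 0) (at x within K))"

(* dim is 0 for infinite-dimensional subspaces, hence this is used with k > 0 only. *)
definition subspace_of_dim :: "nat \<Rightarrow> 'a::real_vector set \<Rightarrow> bool" where
  "subspace_of_dim k V \<longleftrightarrow> subspace V \<and> dim V = k"

definition direct_sum :: "'a::real_vector set \<Rightarrow> 'a set \<Rightarrow> bool" where
  "direct_sum V W \<longleftrightarrow> V \<inter> W = {0} \<and> {v + w | v w. v \<in> V \<and> w \<in> W} = UNIV"

definition subspace_of_codim :: "nat \<Rightarrow> 'a::real_vector set \<Rightarrow> bool" where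
  "subspace_of_codim k W \<longleftrightarrow> subspace W \<and> (\<exists>V. subspace_of_dim k V \<and> direct_sum V W)"

definition common_kernel :: "('a::real_normed_vector \<Rightarrow>\<^sub>L real) set \<Rightarrow> 'a set" where
  "common_kernel L = {v. \<forall>l\<in>L. blinfun_apply l v = 0}"

definition exponential_separation ::
  "nat \<Rightarrow> 'a::real_normed_vector set \<Rightarrow> ('a \<Rightarrow> 'a) \<Rightarrow> ('a \<Rightarrow> 'a \<Rightarrow>\<^sub>L 'a) \<Rightarrow> bool" where
  "exponential_separation k K F T \<longleftrightarrow> k > 0 \<and>
     (\<exists>(P :: 'a \<Rightarrow> 'a set) (Q :: 'a \<Rightarrow> 'a set) (L :: 'a \<Rightarrow> ('a \<Rightarrow>\<^sub>L real) set).
        (\<forall>x\<in>K. subspace_of_dim k (P x)) \<and> gap_continuous_on K P \<and>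
        (\<forall>x\<in>K. closed (Q x) \<and> subspace_of_codim k (Q x)) \<and>
        (\<forall>x\<in>K. subspace_of_dim k (L x)) \<and> gap_continuous_on K L \<and>
        (\<forall>x\<in>K. Q x = common_kernel (L x)) \<and>
        (\<forall>x\<in>K. direct_sum (P x) (Q x)) \<and>
        (\<forall>x\<in>K. blinfun_apply (T x) ` P x = P (F x)) \<and>
        (\<forall>x\<in>K. blinfun_apply (T x) ` Q x \<subseteq> Q (F x)) \<and>
        (\<exists>M \<gamma>. M > 0 \<and> 0 < \<gamma> \<and> \<gamma> < 1 \<and>
           (\<forall>x\<in>K. \<forall>v\<in>P x \<inter> sphere 0 1. \<forall>w\<in>Q x \<inter> sphere 0 1. \<forall>n.
              norm (blinfun_apply (cocycle_iter F T n x) w)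
                \<le> M * \<gamma> ^ n * norm (blinfun_apply (cocycle_iter F T n x) v))))"

end

theory Submission
  imports Defs
begin

text \<open>
  Write \<open>G = F + R\<close>. By the mean value inequality, \<open>C\<^sup>1\<close>-smallness makes \<open>R\<close> a global contraction
  with a small constant, so \<open>G\<close> is the sum of a completely continuous map and a contraction.
  Although \<open>G\<close> itself need not be completely continuous, it shrinks the ball measure of
  noncompactness of bounded sets, and this is enough for an \<open>\<omega>\<close>-limit set to be a compact attractor.

  The proof has two halves. First, \<open>K\<close> attracts \<open>B\<^sub>1(K)\<close> under \<open>F\<close>, and each single iterate of \<open>G\<close>
  is uniformly close to that of \<open>F\<close> on bounded sets (\<open>iterates_uniformly_close\<close>; uniform continuity
  of \<open>F\<close> is needed only near the relatively compact images of \<open>F\<close>). Hence \<open>G\<^sup>n\<close> maps \<open>B\<^sub>1(K)\<close> into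
  \<open>B\<^sub>\<delta>(K)\<close> for all \<open>n\<close> between some \<open>N\<close> and \<open>2 N\<close>, and then for all \<open>n \<ge> N\<close>, because one may restart
  from \<open>B\<^sub>\<delta>(K) \<subseteq> B\<^sub>1(K)\<close> (\<open>iterates_eventually_in\<close>). Secondly, the orbit of \<open>B\<^sub>1(K)\<close> is now
  bounded, so the measure of noncompactness of its tails decays geometrically
  (\<open>orbit_tails_shrink\<close>), and the \<open>\<omega>\<close>-limit set of \<open>B\<^sub>1(K)\<close> is nonempty, compact, invariant and
  attracts \<open>B\<^sub>1(K)\<close> (\<open>omega_limit_attractor\<close>). It lies in \<open>B\<^sub>\<delta>(K)\<close> because the tails do, and the
  open \<open>1\<close>-neighbourhood of \<open>K\<close> is an attracted neighbourhood of it because \<open>\<delta> < 1\<close>, so it is a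
  local attractor.
\<close>

section \<open>Attraction\<close>

lemma attractsI:
  assumes "\<And>e. e > 0 \<Longrightarrow> \<exists>N. \<forall>n\<ge>N. \<forall>b\<in>B. \<exists>a\<in>A. dist ((f ^^ n) b) a \<le> e"
  shows "attracts f A B"
  unfolding attracts_def
proof (rule order_tendstoI)
  fix c :: ennreal assume "0 < c"
  then obtain d where d: "0 < d" "d < c" using dense by blast
  then have dfin: "d < top" using top.not_eq_extremum by (metis order_less_trans)
  define e where "e = enn2real d"
  have e: "e > 0" "ennreal e = d" using d dfin by (auto simp: e_def enn2real_positive_iff)
  obtain N where N: "\<forall>n\<ge>N. \<forall>b\<in>B. \<exists>a\<in>A. dist ((f ^^ n) b) a \<le> e" using assms e by blast
  have "(SUP b\<in>B. INF a\<in>A. ennreal (dist ((f ^^ n) b) a)) < c" if n: "n \<ge> N" for n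
  proof -
    have "(SUP b\<in>B. INF a\<in>A. ennreal (dist ((f ^^ n) b) a)) \<le> ennreal e"
    proof (rule SUP_least)
      fix b assume "b \<in> B"
      then obtain a where "a \<in> A" "dist ((f ^^ n) b) a \<le> e" using N n by blast
      then show "(INF a\<in>A. ennreal (dist ((f ^^ n) b) a)) \<le> ennreal e"
        by (meson INF_lower2 ennreal_leI)
    qed
    then show ?thesis using e d by simp
  qed
  then show "\<forall>\<^sub>F n in sequentially. (SUP b\<in>B. INF a\<in>A. ennreal (dist ((f ^^ n) b) a)) < c"
    by (auto simp: eventually_sequentially)
qed simp

lemma attractsD:
  assumes "attracts f A B" "e > 0"
  shows "\<exists>N. \<forall>n\<ge>N. \<forall>b\<in>B. \<exists>a\<in>A. dist ((f ^^ n) b) a < e"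
proof -
  have "\<forall>\<^sub>F n in sequentially. (SUP b\<in>B. INF a\<in>A. ennreal (dist ((f ^^ n) b) a)) < ennreal e"
    using assms unfolding attracts_def by (intro order_tendstoD(2)) auto
  then obtain N where
    N: "\<And>n. n \<ge> N \<Longrightarrow> (SUP b\<in>B. INF a\<in>A. ennreal (dist ((f ^^ n) b) a)) < ennreal e"
    by (auto simp: eventually_sequentially)
  have "\<exists>a\<in>A. dist ((f ^^ n) b) a < e" if "n \<ge> N" "b \<in> B" for n b
  proof -
    have "(INF a\<in>A. ennreal (dist ((f ^^ n) b) a)) < ennreal e"
      using N[OF that(1)] SUP_upper[OF that(2), of "\<lambda>b. INF a\<in>A. ennreal (dist ((f ^^ n) b) a)"]
      by (meson order_le_less_trans)
    then show ?thesis by (auto simp: INF_less_iff ennreal_less_iff)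
  qed
  then show ?thesis by blast
qed

lemma attracts_mono:
  assumes "attracts f A B" "C \<subseteq> B"
  shows "attracts f A C"
proof (rule attractsI)
  fix e :: real assume "e > 0"
  then show "\<exists>N. \<forall>n\<ge>N. \<forall>b\<in>C. \<exists>a\<in>A. dist ((f ^^ n) b) a \<le> e"
    using attractsD[OF assms(1)] assms(2) by (meson less_imp_le subsetD)
qed

lemma closed_nbhd_mono: "c \<le> d \<Longrightarrow> closed_nbhd c K \<subseteq> closed_nbhd d K"
  by (auto simp: closed_nbhd_def)

lemma closed_closed_nbhd: "closed (closed_nbhd c K)"
  unfolding closed_nbhd_def by (intro closed_Collect_le continuous_intros)

lemma bounded_closed_nbhd:
  assumes "bounded K" "K \<noteq> {}"
  shows "bounded (closed_nbhd c K)"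
proof -
  obtain x e where xe: "\<And>y. y \<in> K \<Longrightarrow> dist x y \<le> e"
    using assms(1) by (auto simp: bounded_def)
  have "dist x z \<le> e + (c + 1)" if "z \<in> closed_nbhd c K" for z
  proof -
    have "infdist z K < c + 1" using that by (auto simp: closed_nbhd_def)
    then obtain y where "y \<in> K" "dist z y < c + 1"
      using assms(2) by (auto simp: infdist_def cINF_less_iff split: if_splits)
    then show ?thesis using xe[of y] dist_triangle[of x z y] by (auto simp: dist_commute)
  qed
  then show ?thesis by (auto simp: bounded_def)
qed

section \<open>Omega-limit sets of orbits with vanishing noncompactness\<close>

text \<open>The infimum of the admissible \<open>r\<close> is the ball (Hausdorff) measure of noncompactness of \<open>D\<close>.\<close>

definition ball_coverable :: "real \<Rightarrow> 'a::metric_space set \<Rightarrow> bool" where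
  "ball_coverable r D \<longleftrightarrow> (\<exists>T. finite T \<and> D \<subseteq> (\<Union>t\<in>T. cball t r))"

lemma ball_coverable_subset: "ball_coverable r D \<Longrightarrow> C \<subseteq> D \<Longrightarrow> ball_coverable r C"
  unfolding ball_coverable_def by (meson order_trans)

lemma ball_coverable_mono:
  assumes "ball_coverable r D" "r \<le> s"
  shows "ball_coverable s D"
proof -
  obtain T where T: "finite T" "D \<subseteq> (\<Union>t\<in>T. cball t r)"
    using assms(1) by (auto simp: ball_coverable_def)
  moreover have "(\<Union>t\<in>T. cball t r) \<subseteq> (\<Union>t\<in>T. cball t s)"
    using assms(2) by (intro UN_mono subset_cball) auto
  ultimately show ?thesis unfolding ball_coverable_def by (meson order_trans)
qed

lemma ball_coverable_closure:
  assumes "ball_coverable r D"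
  shows "ball_coverable r (closure D)"
proof -
  obtain T where T: "finite T" "D \<subseteq> (\<Union>t\<in>T. cball t r)"
    using assms by (auto simp: ball_coverable_def)
  have "closed (\<Union>t\<in>T. cball t r)" using T by (intro closed_UN) auto
  then show ?thesis using T closure_minimal unfolding ball_coverable_def by meson
qed

lemma ball_coverable_Un:
  assumes "ball_coverable r C" "ball_coverable r D"
  shows "ball_coverable r (C \<union> D)"
proof -
  obtain S T where "finite S" "C \<subseteq> (\<Union>t\<in>S. cball t r)" "finite T" "D \<subseteq> (\<Union>t\<in>T. cball t r)"
    using assms by (auto simp: ball_coverable_def)
  then show ?thesis unfolding ball_coverable_def by (intro exI[of _ "S \<union> T"]) auto
qed

lemma ball_coverable_finite: "finite D \<Longrightarrow> r \<ge> 0 \<Longrightarrow> ball_coverable r D"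
  unfolding ball_coverable_def by (intro exI[of _ D]) force

lemma compact_if_ball_coverable:
  fixes D :: "'a::complete_space set"
  assumes "closed D" "\<And>r. r > 0 \<Longrightarrow> ball_coverable r D"
  shows "compact D"
  unfolding compact_eq_totally_bounded
proof (intro conjI allI impI)
  show "complete D" using assms(1) by (simp add: complete_eq_closed)
next
  fix e :: real assume e: "0 < e"
  then obtain T where "finite T" "D \<subseteq> (\<Union>t\<in>T. cball t (e/2))"
    using assms(2)[of "e/2"] by (auto simp: ball_coverable_def)
  moreover have "(\<Union>t\<in>T. cball t (e/2)) \<subseteq> (\<Union>t\<in>T. ball t e)" using e by (intro UN_mono) auto
  ultimately show "\<exists>k. finite k \<and> D \<subseteq> (\<Union>x\<in>k. ball x e)" by (meson order_trans)
qed

definition orbit_tail :: "('a \<Rightarrow> 'a) \<Rightarrow> 'a set \<Rightarrow> nat \<Rightarrow> 'a set" where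
  "orbit_tail f B n = (\<Union>m\<in>{n..}. (f ^^ m) ` B)"

definition omega_limit :: "('a::topological_space \<Rightarrow> 'a) \<Rightarrow> 'a set \<Rightarrow> 'a set" where
  "omega_limit f B = (\<Inter>n. closure (orbit_tail f B n))"

lemma orbit_tail_antimono: "m \<le> n \<Longrightarrow> orbit_tail f B n \<subseteq> orbit_tail f B m"
  unfolding orbit_tail_def by (intro UN_mono) auto

lemma orbit_tail_Suc: "orbit_tail f B (Suc n) = f ` orbit_tail f B n"
proof -
  have "{Suc n..} = Suc ` {n..}"
    by (auto dest: Suc_le_D)
  then show ?thesis
    by (simp add: orbit_tail_def image_UN image_image)
qed

text \<open>Only finitely many terms of the sequence lie outside a given tail, so the whole sequence is
  totally bounded.\<close>

lemma convergent_subsequence_in_tails: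
  fixes f :: "'a::complete_space \<Rightarrow> 'a"
  assumes small: "\<forall>r>0. \<exists>n. ball_coverable r (orbit_tail f B n)"
    and x: "\<And>n. x n \<in> orbit_tail f B n"
  shows "\<exists>l\<in>omega_limit f B. \<exists>s :: nat \<Rightarrow> nat. strict_mono s \<and> (x \<circ> s) \<longlonglongrightarrow> l"
proof -
  have "compact (closure (range x))"
  proof (intro compact_if_ball_coverable ball_coverable_closure)
    fix r :: real assume r: "r > 0"
    then obtain N where N: "ball_coverable r (orbit_tail f B N)" using small by blast
    have "range x \<subseteq> x ` {..<N} \<union> orbit_tail f B N"
    proof
      fix y assume "y \<in> range x"
      then obtain n where "y = x n" by blast
      then show "y \<in> x ` {..<N} \<union> orbit_tail f B N"
        using x[of n] orbit_tail_antimono[of N n f B] by (cases "n < N") auto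
    qed
    moreover have "ball_coverable r (x ` {..<N} \<union> orbit_tail f B N)"
      using ball_coverable_Un[OF ball_coverable_finite N] r by simp
    ultimately show "ball_coverable r (range x)" using ball_coverable_subset by blast
  qed simp
  moreover have "\<forall>n. x n \<in> closure (range x)" using closure_subset by fastforce
  ultimately obtain l s where s: "strict_mono (s :: nat \<Rightarrow> nat)" "(x \<circ> s) \<longlonglongrightarrow> l"
    using compact_def by metis
  have "l \<in> closure (orbit_tail f B n)" for n
  proof (rule Lim_in_closed_set[OF _ _ _ s(2)])
    have "(x \<circ> s) m \<in> closure (orbit_tail f B n)" if "m \<ge> n" for m
    proof -
      have "n \<le> s m" using that seq_suble[OF s(1), of m] by linarith
      then show ?thesis
        using x[of "s m"] orbit_tail_antimono[of n "s m" f B] closure_subset by fastforce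
    qed
    then show "\<forall>\<^sub>F m in sequentially. (x \<circ> s) m \<in> closure (orbit_tail f B n)"
      by (auto simp: eventually_sequentially)
  qed auto
  then have "l \<in> omega_limit f B" by (auto simp: omega_limit_def)
  then show ?thesis using s by blast
qed

text \<open>Everything follows from the compactness of sequences picked from the tails: applied to
  points of an orbit it gives nonemptiness and (by contradiction) attraction, and applied to
  approximate preimages of a limit point it gives an exact preimage in the limit set.\<close>

lemma omega_limit_attractor:
  fixes f :: "'a::complete_space \<Rightarrow> 'a"
  assumes cont: "continuous_on UNIV f" and "B \<noteq> {}"
    and small: "\<forall>r>0. \<exists>n. ball_coverable r (orbit_tail f B n)"
  shows "omega_limit f B \<noteq> {}" "compact (omega_limit f B)"
    "f ` omega_limit f B = omega_limit f B" "attracts f (omega_limit f B) B"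
proof -
  let ?A = "omega_limit f B"
  show "?A \<noteq> {}"
  proof -
    obtain b where "b \<in> B" using \<open>B \<noteq> {}\<close> by blast
    then have "(f ^^ n) b \<in> orbit_tail f B n" for n by (auto simp: orbit_tail_def)
    from convergent_subsequence_in_tails[OF small this] show ?thesis by (elim bexE) auto
  qed
  show "compact ?A"
  proof (rule compact_if_ball_coverable)
    show "closed ?A" unfolding omega_limit_def by (intro closed_INT) auto
  next
    fix r :: real assume "r > 0"
    then obtain n where "ball_coverable r (closure (orbit_tail f B n))"
      using small ball_coverable_closure by blast
    then show "ball_coverable r ?A"
      by (rule ball_coverable_subset) (auto simp: omega_limit_def)
  qed
  show "f ` ?A = ?A"
  proof
    show "f ` ?A \<subseteq> ?A"
    proof
      fix y assume "y \<in> f ` ?A"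
      then obtain x where x: "x \<in> ?A" "y = f x" by blast
      have "y \<in> closure (orbit_tail f B n)" for n
      proof -
        have "f ` closure (orbit_tail f B n) \<subseteq> closure (orbit_tail f B (Suc n))"
          unfolding orbit_tail_Suc
          by (rule image_closure_subset[OF continuous_on_subset[OF cont]])
            (simp_all add: closure_subset)
        moreover have "closure (orbit_tail f B (Suc n)) \<subseteq> closure (orbit_tail f B n)"
          by (intro closure_mono orbit_tail_antimono) auto
        ultimately show ?thesis using x unfolding omega_limit_def by blast
      qed
      then show "y \<in> ?A" by (auto simp: omega_limit_def)
    qed
    show "?A \<subseteq> f ` ?A"
    proof
      fix x assume x: "x \<in> ?A"
      have "\<exists>y \<in> orbit_tail f B n. dist (f y) x < inverse (real (Suc n))" for n
      proof -
        have "x \<in> closure (f ` orbit_tail f B n)"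
          using x unfolding omega_limit_def orbit_tail_Suc[symmetric] by blast
        then show ?thesis
          using closure_approachable[of x "f ` orbit_tail f B n"] by auto
      qed
      then obtain y where y: "\<And>n. y n \<in> orbit_tail f B n"
        "\<And>n. dist (f (y n)) x < inverse (real (Suc n))" by metis
      obtain l s where ls: "l \<in> ?A" "strict_mono (s :: nat \<Rightarrow> nat)" "(y \<circ> s) \<longlonglongrightarrow> l"
        using convergent_subsequence_in_tails[OF small y(1)] by (elim bexE exE conjE)
      have "(\<lambda>n. f (y n)) \<longlonglongrightarrow> x"
      proof (rule metric_tendsto_imp_tendsto[OF LIMSEQ_inverse_real_of_nat])
        show "\<forall>\<^sub>F n in sequentially. dist (f (y n)) x \<le> dist (inverse (real (Suc n))) 0"
          using y(2) by (auto intro!: always_eventually less_imp_le)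
      qed
      from LIMSEQ_subseq_LIMSEQ[OF this ls(2)]
      have "(\<lambda>n. f ((y \<circ> s) n)) \<longlonglongrightarrow> x" by (simp add: o_def)
      moreover have "(\<lambda>n. f ((y \<circ> s) n)) \<longlonglongrightarrow> f l"
        using continuous_on_tendsto_compose[OF cont ls(3)] by auto
      ultimately have "f l = x" using LIMSEQ_unique by blast
      then show "x \<in> f ` ?A" using ls by blast
    qed
  qed
  show "attracts f ?A B"
  proof (rule attractsI, rule ccontr)
    fix e :: real assume e: "e > 0"
      and "\<not> (\<exists>N. \<forall>n\<ge>N. \<forall>b\<in>B. \<exists>a\<in>?A. dist ((f ^^ n) b) a \<le> e)"
    then have "\<forall>N. \<exists>n\<ge>N. \<exists>b\<in>B. \<forall>a\<in>?A. dist ((f ^^ n) b) a > e" by (meson not_le)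
    moreover have "(f ^^ n) b \<in> orbit_tail f B N" if "n \<ge> N" "b \<in> B" for n b N
      using that by (auto simp: orbit_tail_def)
    ultimately have "\<forall>N. \<exists>x\<in>orbit_tail f B N. \<forall>a\<in>?A. dist x a > e" by meson
    then obtain x where x: "\<And>N. x N \<in> orbit_tail f B N" "\<And>N a. a \<in> ?A \<Longrightarrow> dist (x N) a > e"
      by metis
    obtain l and s :: "nat \<Rightarrow> nat" where ls: "l \<in> ?A" "(x \<circ> s) \<longlonglongrightarrow> l"
      using convergent_subsequence_in_tails[OF small x(1)] by (elim bexE exE conjE)
    then obtain n where "dist ((x \<circ> s) n) l < e" using metric_LIMSEQ_D[OF ls(2) e] by blast
    then show False using x(2)[OF ls(1), of "s n"] by simp
  qed
qed

section \<open>Perturbations of completely continuous maps\<close>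

text \<open>On a ball of radius \<open>r\<close> the difference \<open>g - f\<close> varies by at most \<open>r/4\<close>, and \<open>f\<close> takes its
  values in finitely many balls of radius \<open>r/4\<close>; the sums of the centres are centres for \<open>g\<close>.\<close>

lemma ball_coverable_image_contracted:
  fixes f g :: "'a::real_normed_vector \<Rightarrow> 'a"
  assumes f: "compact (closure (f ` D))"
    and lip: "\<And>x y. norm ((g x - f x) - (g y - f y)) \<le> norm (x - y) / 4"
    and D: "ball_coverable r D" and r: "r > 0"
  shows "ball_coverable (r/2) (g ` D)"
proof -
  obtain T where T: "finite T" "D \<subseteq> (\<Union>t\<in>T. cball t r)"
    using D by (auto simp: ball_coverable_def)
  obtain S where S: "finite S" "closure (f ` D) \<subseteq> (\<Union>s\<in>S. ball s (r/4))"
    using f r unfolding compact_eq_totally_bounded by (meson divide_pos_pos zero_less_numeral)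
  define C where "C = (\<lambda>(s, t). s + (g t - f t)) ` (S \<times> T)"
  have "g ` D \<subseteq> (\<Union>c\<in>C. cball c (r/2))"
  proof
    fix y assume "y \<in> g ` D"
    then obtain x where x: "x \<in> D" "y = g x" by blast
    obtain t where t: "t \<in> T" "norm (t - x) \<le> r" using T x by (auto simp: dist_norm)
    have "f x \<in> closure (f ` D)" using x closure_subset by fastforce
    then obtain s where s: "s \<in> S" "norm (s - f x) < r/4" using S by (auto simp: dist_norm)
    have "norm ((s + (g t - f t)) - g x) = norm ((s - f x) + ((g t - f t) - (g x - f x)))"
      by (simp add: algebra_simps)
    also have "\<dots> \<le> norm (s - f x) + norm ((g t - f t) - (g x - f x))" by (rule norm_triangle_ineq)
    also have "\<dots> \<le> r/2" using s(2) t(2) lip[of t x] by linarith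
    finally have "y \<in> cball (s + (g t - f t)) (r/2)" using x by (simp add: dist_norm)
    then show "y \<in> (\<Union>c\<in>C. cball c (r/2))" using s t unfolding C_def by blast
  qed
  moreover have "finite C" using S T by (simp add: C_def)
  ultimately show ?thesis unfolding ball_coverable_def by blast
qed

text \<open>Each application of \<open>g\<close> halves the covering radius, starting from one ball containing the
  bounded tail.\<close>

lemma orbit_tails_shrink:
  fixes f g :: "'a::real_normed_vector \<Rightarrow> 'a"
  assumes cc: "completely_continuous f"
    and lip: "\<And>x y. norm ((g x - f x) - (g y - f y)) \<le> norm (x - y) / 4"
    and bdd: "bounded (orbit_tail g B N)" and r: "r > 0"
  shows "\<exists>n. ball_coverable r (orbit_tail g B n)"
proof -
  obtain c where c: "c > 0" "orbit_tail g B N \<subseteq> cball 0 c"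
    using bounded_subset_ballD[OF bdd, of 0] ball_subset_cball by blast
  have halve: "ball_coverable (c / 2^n) (orbit_tail g B (N + n))" for n
  proof (induction n)
    case 0
    show ?case using c unfolding ball_coverable_def by (intro exI[of _ "{0}"]) auto
  next
    case (Suc n)
    have "bounded (orbit_tail g B (N + n))"
      using bdd orbit_tail_antimono[of N "N + n" g B] bounded_subset by auto
    then have "compact (closure (f ` orbit_tail g B (N + n)))"
      using cc by (auto simp: completely_continuous_def)
    from ball_coverable_image_contracted[OF this lip Suc] c(1)
    show ?case by (simp add: orbit_tail_Suc field_simps)
  qed
  obtain n where "(1/2) ^ n < r / c"
    using real_arch_pow_inv[of "r / c" "1/2"] r c by auto
  then have "c / 2^n \<le> r" using c by (simp add: field_simps)
  then show ?thesis using ball_coverable_mono[OF halve] by blast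
qed

lemma uniform_continuity_near_compact:
  fixes f :: "'a::metric_space \<Rightarrow> 'b::metric_space"
  assumes "compact C" "continuous_on UNIV f" "e > 0"
  obtains d where "d > 0" "\<And>x y. x \<in> C \<Longrightarrow> dist x y < d \<Longrightarrow> dist (f x) (f y) < e"
proof (rule ccontr)
  assume "\<not> thesis"
  then have "\<forall>n. \<exists>x y. x \<in> C \<and> dist x y < inverse (real (Suc n)) \<and> dist (f x) (f y) \<ge> e"
    using that by (metis inverse_positive_iff_positive not_le of_nat_0_less_iff zero_less_Suc)
  then obtain x y where xy: "\<And>n. x n \<in> C" "\<And>n. dist (x n) (y n) < inverse (real (Suc n))"
    "\<And>n. dist (f (x n)) (f (y n)) \<ge> e" by metis
  obtain l s where ls: "strict_mono (s :: nat \<Rightarrow> nat)" "(x \<circ> s) \<longlonglongrightarrow> l"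
    using assms(1) xy(1) unfolding compact_def by metis
  have "(\<lambda>n. dist (x n) (y n)) \<longlonglongrightarrow> 0"
    by (rule tendsto_sandwich[OF _ _ tendsto_const LIMSEQ_inverse_real_of_nat])
      (use xy(2) in \<open>auto intro!: always_eventually less_imp_le\<close>)
  from LIMSEQ_subseq_LIMSEQ[OF this ls(1)]
  have "(\<lambda>n. dist ((x \<circ> s) n) ((y \<circ> s) n)) \<longlonglongrightarrow> 0" by (simp add: o_def)
  then have sum: "(\<lambda>n. dist ((x \<circ> s) n) l + dist ((x \<circ> s) n) ((y \<circ> s) n)) \<longlonglongrightarrow> 0"
    using iffD1[OF tendsto_dist_iff ls(2)] by (intro tendsto_add_zero)
  have "dist ((y \<circ> s) n) l \<le> dist ((x \<circ> s) n) l + dist ((x \<circ> s) n) ((y \<circ> s) n)" for n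
    using dist_triangle3[of "(y \<circ> s) n" l "(x \<circ> s) n"] by (simp add: add.commute)
  then have "(\<lambda>n. dist ((y \<circ> s) n) l) \<longlonglongrightarrow> 0"
    by (intro tendsto_sandwich[OF _ _ tendsto_const sum] always_eventually allI) simp_all
  then have ys: "(y \<circ> s) \<longlonglongrightarrow> l" using tendsto_dist_iff by blast
  have "(\<lambda>n. dist (f ((x \<circ> s) n)) (f ((y \<circ> s) n))) \<longlonglongrightarrow> dist (f l) (f l)"
    by (intro tendsto_dist continuous_on_tendsto_compose[OF assms(2)] ls(2) ys) auto
  then have "e \<le> dist (f l) (f l)" using xy(3) by (intro LIMSEQ_le_const) auto
  then show False using assms(3) by simp
qed

text \<open>In infinite dimensions \<open>f\<close> need not be uniformly continuous on the bounded set \<open>B\<close>. This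
  does no harm, since the error at the zeroth step vanishes and \<open>f\<^sup>n(B)\<close> is relatively compact
  from the first step on.\<close>

lemma iterates_uniformly_close:
  fixes f :: "'a::metric_space \<Rightarrow> 'a"
  assumes cc: "completely_continuous f" and B: "bounded B" and e: "e > 0"
  shows "\<exists>h>0. \<forall>g. (\<forall>x. dist (g x) (f x) \<le> h) \<longrightarrow> (\<forall>x\<in>B. dist ((g ^^ n) x) ((f ^^ n) x) < e)"
  using e
proof (induction n arbitrary: e)
  case 0
  then show ?case by (auto intro: exI[of _ 1])
next
  case (Suc n)
  have bounded_images: "bounded ((f ^^ m) ` B)" for m
  proof (induction m)
    case (Suc m)
    then have "bounded (closure (f ` (f ^^ m) ` B))"
      using cc unfolding completely_continuous_def by (intro compact_imp_bounded) blast
    then have "bounded (f ` (f ^^ m) ` B)" using closure_subset bounded_subset by blast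
    then show ?case by (simp add: image_image)
  qed (use B in simp)
  have step: "\<exists>d>0. \<forall>x\<in>B. \<forall>y. dist y ((f ^^ n) x) < d \<and> (n = 0 \<longrightarrow> y = x)
      \<longrightarrow> dist (f y) ((f ^^ Suc n) x) < e/2"
  proof (cases n)
    case 0
    then show ?thesis using Suc.prems by (intro exI[of _ 1]) auto
  next
    case (Suc m)
    define C where "C = closure (f ` (f ^^ m) ` B)"
    have "compact C"
      using cc bounded_images[of m] unfolding completely_continuous_def C_def by blast
    then obtain d where d: "d > 0" "\<And>x y. x \<in> C \<Longrightarrow> dist x y < d \<Longrightarrow> dist (f x) (f y) < e/2"
      using uniform_continuity_near_compact[of C f "e/2"] cc \<open>e > 0\<close>
      unfolding completely_continuous_def by auto
    have "(f ^^ n) x \<in> C" if "x \<in> B" for x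
      using that closure_subset[of "f ` (f ^^ m) ` B"] Suc by (auto simp: C_def)
    moreover have "dist (f y) (f x) < e/2" if "x \<in> C" "dist y x < d" for x y
      using d(2)[of x y] that by (simp add: dist_commute)
    ultimately show ?thesis using d(1) by (intro exI[of _ d]) simp
  qed
  then obtain d where d: "d > 0" "\<forall>x\<in>B. \<forall>y. dist y ((f ^^ n) x) < d \<and> (n = 0 \<longrightarrow> y = x)
      \<longrightarrow> dist (f y) ((f ^^ Suc n) x) < e/2" by (elim exE conjE)
  obtain h where h: "h > 0"
    "\<And>g x. (\<And>x. dist (g x) (f x) \<le> h) \<Longrightarrow> x \<in> B \<Longrightarrow> dist ((g ^^ n) x) ((f ^^ n) x) < d"
    using Suc.IH[OF d(1)] by blast
  show ?case
  proof (intro exI[of _ "min h (e/2)"] conjI allI impI ballI)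
    show "min h (e/2) > 0" using h Suc.prems by simp
  next
    fix g x assume g: "\<forall>x. dist (g x) (f x) \<le> min h (e/2)" and x: "x \<in> B"
    have "dist ((g ^^ n) x) ((f ^^ n) x) < d" using g x by (intro h(2)) auto
    then have "dist (f ((g ^^ n) x)) ((f ^^ Suc n) x) < e/2"
      using d(2) x by auto
    moreover have "dist (g ((g ^^ n) x)) (f ((g ^^ n) x)) \<le> e/2" using g by simp
    ultimately show "dist ((g ^^ Suc n) x) ((f ^^ Suc n) x) < e"
      using dist_triangle[of "g ((g ^^ n) x)" "(f ^^ Suc n) x" "f ((g ^^ n) x)"] by simp
  qed
qed

text \<open>After \<open>N\<close> steps every orbit is back in \<open>B\<close>, so the behaviour on the window from \<open>N\<close> to \<open>2 N\<close>
  repeats itself for ever.\<close>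

lemma iterates_eventually_in:
  fixes g :: "'a \<Rightarrow> 'a"
  assumes "N > 0" "C \<subseteq> B"
    and window: "\<And>n. N \<le> n \<Longrightarrow> n \<le> 2 * N \<Longrightarrow> (g ^^ n) ` B \<subseteq> C"
    and "n \<ge> N"
  shows "(g ^^ n) ` B \<subseteq> C"
  using \<open>n \<ge> N\<close>
proof (induction n rule: less_induct)
  case (less n)
  show ?case
  proof (cases "n \<le> 2 * N")
    case False
    then have "(g ^^ (n - N)) ` B \<subseteq> C" using less.IH[of "n - N"] assms(1) by auto
    moreover have "(g ^^ N) ` B \<subseteq> B" using window[of N] assms(2) by auto
    moreover have "(g ^^ n) ` B = (g ^^ (n - N)) ` (g ^^ N) ` B"
      using False funpow_add[of "n - N" N g] by (simp add: image_comp)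
    ultimately show ?thesis by blast
  qed (use less window in auto)
qed

text \<open>The smallest of the finitely many tolerances that \<open>iterates_uniformly_close\<close> provides for the
  iterates between \<open>N\<close> and \<open>2 N\<close> serves, by \<open>iterates_eventually_in\<close>, for all later ones.\<close>

lemma perturbed_iterates_eventually_near:
  fixes F :: "'a::metric_space \<Rightarrow> 'a"
  assumes cc: "completely_continuous F" and "bounded K" "K \<noteq> {}"
    and attr: "attracts F K (closed_nbhd c K)" and d: "0 < d" "d \<le> c"
  shows "\<exists>h>0. \<exists>N. \<forall>G. (\<forall>x. dist (G x) (F x) \<le> h)
           \<longrightarrow> (\<forall>n\<ge>N. (G ^^ n) ` closed_nbhd c K \<subseteq> closed_nbhd d K)"
proof -
  let ?B = "closed_nbhd c K"
  obtain N0 where N0: "\<And>n b. n \<ge> N0 \<Longrightarrow> b \<in> ?B \<Longrightarrow> \<exists>a\<in>K. dist ((F ^^ n) b) a < d/2"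
    using attractsD[OF attr, of "d/2"] d by auto
  \<comment> \<open>A restart after \<open>N\<close> steps makes progress only if \<open>N > 0\<close>.\<close>
  define N where "N = Suc N0"
  have "\<forall>n. \<exists>h>0. \<forall>g. (\<forall>x. dist (g x) (F x) \<le> h)
      \<longrightarrow> (\<forall>x\<in>?B. dist ((g ^^ n) x) ((F ^^ n) x) < d/2)"
    using iterates_uniformly_close[OF cc bounded_closed_nbhd[OF assms(2,3)]] d(1)
    by (meson half_gt_zero)
  then obtain h where hpos: "\<And>n. h n > 0"
    and h: "\<And>n g x. (\<And>x. dist (g x) (F x) \<le> h n) \<Longrightarrow> x \<in> ?B
      \<Longrightarrow> dist ((g ^^ n) x) ((F ^^ n) x) < d/2" by metis
  define h0 where "h0 = Min (h ` {N..2*N})"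
  have "h0 > 0" using hpos by (auto simp: h0_def)
  have h0: "h0 \<le> h n" if "N \<le> n" "n \<le> 2*N" for n using that by (auto simp: h0_def)
  have "(G ^^ n) ` ?B \<subseteq> closed_nbhd d K" if G: "\<forall>x. dist (G x) (F x) \<le> h0" and "n \<ge> N" for G n
  proof (rule iterates_eventually_in[OF _ closed_nbhd_mono[OF d(2)] _ \<open>n \<ge> N\<close>])
    fix n assume n: "N \<le> n" "n \<le> 2 * N"
    show "(G ^^ n) ` ?B \<subseteq> closed_nbhd d K"
    proof clarify
      fix b assume b: "b \<in> ?B"
      then obtain a where a: "a \<in> K" "dist ((F ^^ n) b) a < d/2"
        using N0[of n b] n N_def by auto
      have "dist ((G ^^ n) b) ((F ^^ n) b) < d/2"
        by (rule h[OF _ b]) (use G h0[OF n] in \<open>meson order_trans\<close>)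
      then have "dist ((G ^^ n) b) a \<le> d"
        using a dist_triangle[of "(G ^^ n) b" a "(F ^^ n) b"] by linarith
      then show "(G ^^ n) b \<in> closed_nbhd d K"
        using infdist_le2[OF a(1)] by (simp add: closed_nbhd_def)
    qed
  qed (simp add: N_def)
  then show ?thesis using \<open>h0 > 0\<close> by blast
qed

lemma C1_map_has_derivative:
  assumes "C1_map f"
  shows "(f has_derivative blinfun_apply (fderiv f x)) (at x)"
proof -
  have "(f has_derivative frechet_derivative f (at x)) (at x)"
    using assms by (simp add: C1_map_def frechet_derivative_works)
  then show ?thesis
    by (simp add: fderiv_def bounded_linear_Blinfun_apply has_derivative_bounded_linear)
qed

lemma C1_map_continuous: "C1_map f \<Longrightarrow> continuous_on UNIV f"
  by (meson C1_map_has_derivative has_derivative_continuous continuous_at_imp_continuous_on)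

lemma C1_close_imp_difference_Lipschitz:
  fixes f g :: "'a::real_normed_vector \<Rightarrow> 'b::real_normed_vector"
  assumes "C1_map f" "C1_map g" and close: "\<And>x. norm (fderiv g x - fderiv f x) \<le> c"
  shows "norm ((g x - f x) - (g y - f y)) \<le> c * norm (x - y)"
proof (rule differentiable_bound[of UNIV "\<lambda>x. g x - f x"])
  fix x
  have "((\<lambda>x. g x - f x) has_derivative (\<lambda>v. fderiv g x v - fderiv f x v)) (at x)"
    using assms by (intro has_derivative_diff C1_map_has_derivative)
  then show "((\<lambda>x. g x - f x) has_derivative blinfun_apply (fderiv g x - fderiv f x)) (at x)"
    by (simp add: blinfun.diff_left[abs_def])
  show "onorm (blinfun_apply (fderiv g x - fderiv f x)) \<le> c"
    using close[of x] by (simp add: norm_blinfun.rep_eq)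
qed auto

section \<open>Persistence of the attractor\<close>

theorem theorem6p2:
  fixes F :: "'a::banach \<Rightarrow> 'a" and K :: "'a set" and k :: nat
  assumes "completely_continuous F"
    and "point_dissipative F"
    and "C1_map F"
    and "global_attractor F K"
    and "connected K"
    and "\<exists>g. homeomorphism K K F g"
    and "k > 0"
    and "exponential_separation k K F (fderiv F)"
  shows "\<exists>\<delta>\<^sub>0>0. \<forall>\<delta>. 0 < \<delta> \<and> \<delta> < 1 \<and> \<delta> < \<delta>\<^sub>0 \<longrightarrow>
           (\<exists>\<eta>\<^sub>0>0. \<forall>\<eta>\<in>{0..\<eta>\<^sub>0}. \<forall>G :: 'a \<Rightarrow> 'a.
              C1_map G \<and>
              (SUP x. ennreal (norm (G x - F x) + norm (fderiv G x - fderiv F x))) \<le> ennreal \<eta> \<longrightarrow>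
              (\<exists>A. local_attractor G A \<and> A \<subseteq> closed_nbhd \<delta> K \<and>
                   (\<forall>B. bounded B \<and> B \<subseteq> closed_nbhd 1 K \<longrightarrow> attracts G A B)))"
proof (rule exI[of _ 1], intro conjI allI impI)
  fix \<delta> :: real assume \<delta>: "0 < \<delta> \<and> \<delta> < 1 \<and> \<delta> < 1"
  let ?B = "closed_nbhd 1 K"
  have K: "compact K" "\<And>B. bounded B \<Longrightarrow> attracts F K B"
    using assms(4) by (auto simp: global_attractor_def)
  \<comment> \<open>The empty set attracts no point, because an infimum over it is infinite.\<close>
  have "K \<noteq> {}" using attractsD[OF K(2)[of "{0}"], of 1] by auto
  note bounded_nbhd = bounded_closed_nbhd[OF compact_imp_bounded[OF K(1)] \<open>K \<noteq> {}\<close>]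
  have "\<exists>h>0. \<exists>N. \<forall>G. (\<forall>x. dist (G x) (F x) \<le> h)
      \<longrightarrow> (\<forall>n\<ge>N. (G ^^ n) ` ?B \<subseteq> closed_nbhd \<delta> K)"
    using \<delta> by (intro perturbed_iterates_eventually_near[OF assms(1) compact_imp_bounded[OF K(1)]
        \<open>K \<noteq> {}\<close> K(2)[OF bounded_nbhd]]) auto
  then obtain h N where h: "h > 0"
    "\<And>G n. (\<And>x. dist (G x) (F x) \<le> h) \<Longrightarrow> n \<ge> N \<Longrightarrow> (G ^^ n) ` ?B \<subseteq> closed_nbhd \<delta> K"
    by blast
  show "\<exists>\<eta>\<^sub>0>0. \<forall>\<eta>\<in>{0..\<eta>\<^sub>0}. \<forall>G :: 'a \<Rightarrow> 'a.
      C1_map G \<and>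
      (SUP x. ennreal (norm (G x - F x) + norm (fderiv G x - fderiv F x))) \<le> ennreal \<eta> \<longrightarrow>
      (\<exists>A. local_attractor G A \<and> A \<subseteq> closed_nbhd \<delta> K \<and>
           (\<forall>B. bounded B \<and> B \<subseteq> closed_nbhd 1 K \<longrightarrow> attracts G A B))"
    \<comment> \<open>The bound \<open>h\<close> keeps the iterates near \<open>K\<close>, the bound \<open>1/4\<close> makes \<open>G - F\<close> contract.\<close>
  proof (intro exI[of _ "min h (1/4)"] conjI ballI allI impI)
    show "min h (1/4) > 0" using h by simp
  next
    fix \<eta> :: real and G :: "'a \<Rightarrow> 'a"
    assume \<eta>: "\<eta> \<in> {0..min h (1/4)}"
      and G: "C1_map G \<and>
        (SUP x. ennreal (norm (G x - F x) + norm (fderiv G x - fderiv F x))) \<le> ennreal \<eta>"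
    have close: "norm (G x - F x) + norm (fderiv G x - fderiv F x) \<le> \<eta>" for x
    proof -
      have "ennreal (norm (G x - F x) + norm (fderiv G x - fderiv F x)) \<le> ennreal \<eta>"
        using G by (meson SUP_le_iff UNIV_I)
      then show ?thesis using \<eta> by (subst (asm) ennreal_le_iff) auto
    qed
    have "dist (G x) (F x) \<le> h" for x
      using close[of x] \<eta> norm_ge_zero[of "fderiv G x - fderiv F x"]
      unfolding dist_norm by (simp del: norm_ge_zero)
    then have iter: "(G ^^ n) ` ?B \<subseteq> closed_nbhd \<delta> K" if "n \<ge> N" for n using h(2) that by blast
    have "norm (fderiv G x - fderiv F x) \<le> 1/4" for x
      using close[of x] \<eta> norm_ge_zero[of "G x - F x"] by (simp del: norm_ge_zero)
    from C1_close_imp_difference_Lipschitz[OF assms(3) _ this] G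
    have lip: "norm ((G x - F x) - (G y - F y)) \<le> norm (x - y) / 4" for x y by simp
    have tail: "orbit_tail G ?B N \<subseteq> closed_nbhd \<delta> K"
      using iter by (auto simp: orbit_tail_def)
    have "bounded (orbit_tail G ?B N)" using bounded_subset[OF bounded_nbhd tail] .
    then have small: "\<forall>r>0. \<exists>n. ball_coverable r (orbit_tail G ?B n)"
      using orbit_tails_shrink[OF assms(1) lip] by blast
    define A where "A = omega_limit G ?B"
    have "?B \<noteq> {}" using \<open>K \<noteq> {}\<close> unfolding closed_nbhd_def
      by (metis (mono_tags) empty_iff ex_in_conv infdist_zero mem_Collect_eq zero_le_one)
    then have A: "A \<noteq> {}" "compact A" "G ` A = A" "attracts G A ?B"
      unfolding A_def using G small by (intro omega_limit_attractor C1_map_continuous; blast)+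
    have sub: "A \<subseteq> closed_nbhd \<delta> K"
      using closure_minimal[OF tail closed_closed_nbhd] by (auto simp: A_def omega_limit_def)
    define U where "U = {x. infdist x K < 1}"
    have "open U" unfolding U_def by (intro open_Collect_less continuous_intros)
    moreover have "A \<subseteq> U" using sub \<delta> by (auto simp: U_def closed_nbhd_def)
    moreover have "attracts G A U"
      using A(4) G by (rule_tac attracts_mono[of _ _ ?B]) (auto simp: U_def closed_nbhd_def)
    ultimately have "local_attractor G A" using A G unfolding local_attractor_def by blast
    moreover have "attracts G A B" if "B \<subseteq> ?B" for B using A(4) G that attracts_mono by blast
    ultimately show "\<exists>A. local_attractor G A \<and> A \<subseteq> closed_nbhd \<delta> K \<and>
        (\<forall>B. bounded B \<and> B \<subseteq> closed_nbhd 1 K \<longrightarrow> attracts G A B)"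
      using sub by blast
  qed
qed simp

end
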